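(* Let $B$ be a unital algebra and let $A$ be an algebra over $B$ (i.e. $1_B=1_A\in B\subset A$). Let $(A,\varphi)$ be a noncommutative probability space and let $(A,E)$ be a noncommutative probability space over $B$, with $B$-functional $E:A\to B$. Suppose that $(A,\varphi)$ and $(A,E)$ are compatible, and let $x_1,\dots,x_s\in A$ ($s\in\mathbb{N}$). Then for all $n\in\mathbb{N}$ and all $(i_1,\dots,i_n)\in\{1,\dots,s\}^n$, the scalar-valued cumulants satisfy $$k_n(x_{i_1},\dots,x_{i_n})=\sum_{\pi\in NC(n)}\Big(\prod_{(v_1,\dots,v_k)\in\pi}\varphi\big(E(x_{i_{v_1}}\cdots x_{i_{v_k}})\big)\Big)\mu(\pi,1_n),$$ and the scalar-valued moments satisfy $$\varphi(x_{i_1}\cdots x_{i_n})=\sum_{\pi\in NC(n)}\ \prod_{(v_1,\dots,v_k)\in\pi}\Big(\sum_{\theta\in NC(k)}\Big(\prod_{(w_1,\dots,w_l)\in\theta}\varphi\big(E(x_{i_{v_{w_1}}}\cdots x_{i_{v_{w_l}}})\big)\Big)\mu(\theta,1_k)\Big).$$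
   Context: All algebras are over $\mathbb{C}$. A noncommutative probability space $(A,\varphi)$ is a unital algebra $A$ with a linear functional $\varphi:A\to\mathbb{C}$, $\varphi(1)=1$. A noncommutative probability space over $B$ is a pair $(A,E)$ where $1_B=1_A\in B\subset A$ and $E:A\to B$ is a $B$-functional: a linear map with $E(b)=b$ and $E(bab')=bE(a)b'$ for all $b,b'\in B$, $a\in A$. $(A,\varphi)$ and $(A,E)$ are compatible if $\varphi(a)=\varphi(E(a))$ for all $a\in A$. $NC(n)$ is the lattice of noncrossing partitions of $\{1,\dots,n\}$, ordered by $\theta\le\pi$ iff each block of $\theta$ is contained in a block of $\pi$; $1_n$ is its maximal element; $\mu$ is the Möbius function of these lattices. Blocks are written $(v_1,\dots,v_k)$ with $v_1<\dots<v_k$. The scalar-valued cumulants are the multilinear functionals $k_n:A^n\to\mathbb{C}$ determined by $\varphi(a_1\cdots a_n)=\sum_{\pi\in NC(n)}\prod_{(v_1,\dots,v_k)\in\pi}k_k(a_{v_1},\dots,a_{v_k})$ for all $n$. *)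

theory Defs
  imports Complex_Main "HOL-Library.Disjoint_Sets"
begin

section \<open>Noncrossing partitions and their Moebius function\<close>

definition noncrossing :: "nat set set \<Rightarrow> bool" where
  "noncrossing \<pi> \<longleftrightarrow>
     (\<forall>V\<in>\<pi>. \<forall>W\<in>\<pi>. V \<noteq> W \<longrightarrow>
        \<not> (\<exists>a\<in>V. \<exists>b\<in>W. \<exists>c\<in>V. \<exists>d\<in>W. a < b \<and> b < c \<and> c < d))"

definition NC :: "nat \<Rightarrow> nat set set set" where
  "NC n = {\<pi>. partition_on {1..n} \<pi> \<and> noncrossing \<pi>}"

lemma finite_NC: "finite (NC n)"
  by (rule finite_subset[of _ "Pow (Pow {1..n})"]) (auto simp: NC_def partition_on_def)

text \<open>
  The order on \<^term>\<open>NC n\<close> is refinement, \<^term>\<open>refines {1..n} \<theta> \<pi>\<close>. The Moebius function is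
  given by its usual recursion: \<open>\<mu>(\<pi>,\<pi>) = 1\<close> and, for \<open>\<pi> < \<sigma>\<close>,
  \<open>\<mu>(\<pi>,\<sigma>) = - (\<Sum>\<pi>\<le>\<tau><\<sigma>. \<mu>(\<pi>,\<tau>))\<close>.
\<close>

function nc_moebius :: "nat \<Rightarrow> nat set set \<Rightarrow> nat set set \<Rightarrow> int" where
  "nc_moebius n \<pi> \<sigma> =
     (if \<pi> = \<sigma> then 1
      else if refines {1..n} \<pi> \<sigma> then
        - (\<Sum>\<tau> \<in> {\<tau> \<in> NC n. refines {1..n} \<pi> \<tau> \<and> refines {1..n} \<tau> \<sigma> \<and> \<tau> \<noteq> \<sigma>}.
             nc_moebius n \<pi> \<tau>)
      else 0)"
  by pat_completeness auto
termination
proof (relation "measure (\<lambda>(n, \<pi>, \<sigma>). card {\<rho> \<in> NC n. refines {1..n} \<rho> \<sigma> \<and> \<rho> \<noteq> \<sigma>})")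
  fix n :: nat and \<pi> \<sigma> \<tau> :: "nat set set"
  assume \<tau>: "\<tau> \<in> {\<tau> \<in> NC n. refines {1..n} \<pi> \<tau> \<and> refines {1..n} \<tau> \<sigma> \<and> \<tau> \<noteq> \<sigma>}"
  have "{\<rho> \<in> NC n. refines {1..n} \<rho> \<tau> \<and> \<rho> \<noteq> \<tau>} \<subset> {\<rho> \<in> NC n. refines {1..n} \<rho> \<sigma> \<and> \<rho> \<noteq> \<sigma>}"
  proof
    show "{\<rho> \<in> NC n. refines {1..n} \<rho> \<tau> \<and> \<rho> \<noteq> \<tau>} \<subseteq> {\<rho> \<in> NC n. refines {1..n} \<rho> \<sigma> \<and> \<rho> \<noteq> \<sigma>}"
      using \<tau> refines_trans[of "{1..n}" _ \<tau> \<sigma>] refines_asym[of "{1..n}" \<tau> \<sigma>] by blast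
    show "{\<rho> \<in> NC n. refines {1..n} \<rho> \<tau> \<and> \<rho> \<noteq> \<tau>} \<noteq> {\<rho> \<in> NC n. refines {1..n} \<rho> \<sigma> \<and> \<rho> \<noteq> \<sigma>}"
      using \<tau> by blast
  qed
  then show "((n, \<pi>, \<tau>), (n, \<pi>, \<sigma>)) \<in>
      measure (\<lambda>(n, \<pi>, \<sigma>). card {\<rho> \<in> NC n. refines {1..n} \<rho> \<sigma> \<and> \<rho> \<noteq> \<sigma>})"
    by (simp add: psubset_card_mono finite_NC)
qed simp

declare nc_moebius.simps [simp del]

text \<open>For \<open>n > 0\<close> this is the maximal element of \<^term>\<open>NC n\<close>.\<close>

definition nc_top :: "nat \<Rightarrow> nat set set" where
  "nc_top n = {{1..n}}"

text \<open>
  A block \<open>V = (v\<^sub>1, \<dots>, v\<^sub>k)\<close> with \<open>v\<^sub>1 < \<dots> < v\<^sub>k\<close> is a set of numbers; \<open>block_nth V j\<close> is \<open>v\<^sub>j\<close>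
  (counting from 1), and \<open>restrict_block a V\<close> is the tuple \<open>(a v\<^sub>1, \<dots>, a v\<^sub>k)\<close>.
\<close>

definition block_nth :: "nat set \<Rightarrow> nat \<Rightarrow> nat" where
  "block_nth V j = sorted_list_of_set V ! (j - 1)"

definition restrict_block :: "(nat \<Rightarrow> 'a) \<Rightarrow> nat set \<Rightarrow> 'a list" where
  "restrict_block a V = map a (sorted_list_of_set V)"


section \<open>Noncommutative probability spaces\<close>

locale complex_algebra = vector_space scale
  for scale :: "complex \<Rightarrow> 'a::ring_1 \<Rightarrow> 'a" +
  assumes scale_mult_left: "scale c x * y = scale c (x * y)"
    and scale_mult_right: "x * scale c y = scale c (x * y)"
begin

definition unital_subalgebra :: "'a set \<Rightarrow> bool" where
  "unital_subalgebra B \<longleftrightarrow> subspace B \<and> 1 \<in> B \<and> (\<forall>x\<in>B. \<forall>y\<in>B. x * y \<in> B)"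

end

locale nc_prob_space = complex_algebra scale
  for scale :: "complex \<Rightarrow> 'a::ring_1 \<Rightarrow> 'a" +
  fixes \<phi> :: "'a \<Rightarrow> complex"
  assumes linear_state: "Vector_Spaces.linear scale (*) \<phi>"
    and state_one: "\<phi> 1 = 1"

text \<open>The algebra \<open>A\<close> is the whole type; the functional \<open>E\<close> takes its values in the subset \<open>B\<close>.\<close>

locale nc_prob_space_over = complex_algebra scale
  for scale :: "complex \<Rightarrow> 'a::ring_1 \<Rightarrow> 'a" +
  fixes B :: "'a set" and E :: "'a \<Rightarrow> 'a"
  assumes subalgebra: "unital_subalgebra B"
    and linear_E: "Vector_Spaces.linear scale scale E"
    and E_in: "E a \<in> B"
    and E_id: "b \<in> B \<Longrightarrow> E b = b"
    and E_bimodule: "b \<in> B \<Longrightarrow> b' \<in> B \<Longrightarrow> E (b * a * b') = b * E a * b'"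

definition compatible :: "('a \<Rightarrow> complex) \<Rightarrow> ('a \<Rightarrow> 'a) \<Rightarrow> bool" where
  "compatible \<phi> E \<longleftrightarrow> (\<forall>a. \<phi> a = \<phi> (E a))"


section \<open>Scalar-valued cumulants\<close>

text \<open>
  A family \<open>k\<^sub>n : A\<^sup>n \<rightarrow> \<complex>\<close> is a function on lists, \<open>k\<^sub>n\<close> being its restriction to lists of
  length \<open>n\<close>. The value on the empty list is irrelevant (see \<open>free_cumulants_unique\<close>).
\<close>

definition free_cumulants ::
  "(complex \<Rightarrow> 'a::ring_1 \<Rightarrow> 'a) \<Rightarrow> ('a \<Rightarrow> complex) \<Rightarrow> ('a list \<Rightarrow> complex) \<Rightarrow> bool" where
  "free_cumulants scale \<phi> k \<longleftrightarrow>
     (\<forall>us vs. Vector_Spaces.linear scale (*) (\<lambda>a. k (us @ a # vs))) \<and>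
     (\<forall>n\<ge>1. \<forall>a. \<phi> (prod_list (map a [1..<Suc n])) =
        (\<Sum>\<pi>\<in>NC n. \<Prod>V\<in>\<pi>. k (restrict_block a V)))"

text \<open>
  The remaining part of the section shows that the moment-cumulant formula determines a
  unique family of multilinear functionals.
\<close>

lemma nc_top_in_NC: "n \<ge> 1 \<Longrightarrow> nc_top n \<in> NC n"
  by (auto simp: nc_top_def NC_def noncrossing_def partition_on_def)

lemma card_block_less:
  assumes "\<pi> \<in> NC n - {nc_top n}" "V \<in> \<pi>"
  shows "card V < n"
proof -
  have p: "partition_on {1..n} \<pi>" using assms by (auto simp: NC_def)
  have sub: "V \<subseteq> {1..n}" using p assms by (auto simp: partition_on_def)
  have "V \<noteq> {1..n}"
  proof
    assume V: "V = {1..n}"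
    have "W = V" if W: "W \<in> \<pi>" for W
    proof (rule ccontr)
      assume "W \<noteq> V"
      then have "W \<inter> V = {}" using p W assms(2) by (auto simp: partition_on_def disjoint_def)
      moreover have "W \<subseteq> {1..n}" "W \<noteq> {}" using p W by (auto simp: partition_on_def)
      ultimately show False using V by blast
    qed
    then have "\<pi> = {{1..n}}" using assms(2) V by blast
    then show False using assms(1) by (simp add: nc_top_def)
  qed
  then have "V \<subset> {1..n}" using sub by blast
  then show ?thesis using psubset_card_mono[of "{1..n}" V] by simp
qed

lemma length_restrict_block [simp]: "length (restrict_block a V) = card V"
  by (simp add: restrict_block_def)

lemma restrict_block_cong: "finite V \<Longrightarrow> (\<And>v. v \<in> V \<Longrightarrow> a v = b v) \<Longrightarrow> restrict_block a V = restrict_block b V"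
  by (simp add: restrict_block_def)

lemma restrict_block_full: "restrict_block a {1..n} = map a [1..<Suc n]"
  by (metis atLeastLessThanSuc_atLeastAtMost restrict_block_def sorted_list_of_set_range)

lemma NC_block: "\<pi> \<in> NC n \<Longrightarrow> V \<in> \<pi> \<Longrightarrow> V \<subseteq> {1..n} \<and> finite V"
  by (metis (no_types, lifting) NC_def Union_upper finite_atLeastAtMost finite_subset mem_Collect_eq partition_on_def)

lemma finite_NC_mem: "\<pi> \<in> NC n \<Longrightarrow> finite \<pi>"
  by (auto simp: NC_def intro: finite_elements)

function rec_cumulant :: "('a::ring_1 \<Rightarrow> complex) \<Rightarrow> 'a list \<Rightarrow> complex" where
  "rec_cumulant \<phi> as = \<phi> (prod_list as) -
     (\<Sum>\<pi>\<in>NC (length as) - {nc_top (length as)}.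
        \<Prod>V\<in>\<pi>. rec_cumulant \<phi> (restrict_block (\<lambda>j. as ! (j - 1)) V))"
  by pat_completeness auto
termination
  by (relation "measure (length \<circ> snd)") (auto intro: card_block_less)

declare rec_cumulant.simps [simp del]

lemma rec_cumulant_linear:
  fixes scale :: "complex \<Rightarrow> 'a::ring_1 \<Rightarrow> 'a"
  assumes "nc_prob_space scale \<phi>"
  shows "rec_cumulant \<phi> (us @ (x + y) # vs) =
           rec_cumulant \<phi> (us @ x # vs) + rec_cumulant \<phi> (us @ y # vs) \<and>
         rec_cumulant \<phi> (us @ scale c x # vs) = c * rec_cumulant \<phi> (us @ x # vs)"
proof (induction "length us + length vs" arbitrary: us vs rule: less_induct)
  case less
  interpret nc_prob_space scale \<phi> by fact
  interpret phi: Vector_Spaces.linear scale "(*)" \<phi> by (rule linear_state)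
  define n where "n = Suc (length us + length vs)"
  define q where "q = Suc (length us)"
  define T where "T = (\<lambda>z \<pi>. \<Prod>V\<in>\<pi>. rec_cumulant \<phi> (restrict_block (\<lambda>j. (us @ z # vs) ! (j - 1)) V))"
  have rc: "rec_cumulant \<phi> (us @ z # vs) =
      \<phi> (prod_list us * (z * prod_list vs)) - (\<Sum>\<pi>\<in>NC n - {nc_top n}. T z \<pi>)" for z
    by (subst rec_cumulant.simps) (simp add: n_def T_def)
  have *: "T (x + y) \<pi> = T x \<pi> + T y \<pi> \<and> T (scale c x) \<pi> = c * T x \<pi>"
    if \<pi>: "\<pi> \<in> NC n - {nc_top n}" for \<pi>
  proof -
    have p: "partition_on {1..n} \<pi>" using \<pi> by (simp add: NC_def)
    have "q \<in> \<Union>\<pi>" using p by (auto simp: partition_on_def q_def n_def)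
    then obtain V where V: "V \<in> \<pi>" "q \<in> V" by blast
    have fin: "finite \<pi>" using \<pi> finite_NC_mem by blast
    have other: "q \<notin> W" if "W \<in> \<pi> - {V}" for W
      using p V that by (auto simp: partition_on_def disjoint_def)
    define R where "R = (\<Prod>W\<in>\<pi> - {V}. rec_cumulant \<phi> (restrict_block (\<lambda>j. (us @ 0 # vs) ! (j - 1)) W))"
    have fV: "finite V" and V1: "V \<subseteq> {1..n}" using \<pi> V NC_block by blast+
    have "q \<in> set (sorted_list_of_set V)" using V fV by simp
    then obtain ls rs where lr: "sorted_list_of_set V = ls @ q # rs"
      by (meson split_list)
    have dist: "q \<notin> set ls" "q \<notin> set rs"
      using lr distinct_sorted_list_of_set[of V] by auto
    have sV: "set ls \<subseteq> {1..n}" "set rs \<subseteq> {1..n}"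
      using lr V1 set_sorted_list_of_set[OF fV] by auto
    have nth: "(us @ z # vs) ! (j - 1) = (us @ 0 # vs) ! (j - 1)" if "j \<noteq> q" "j \<in> {1..n}" for j z
      using that by (auto simp: nth_append nth_Cons' q_def)
    define us' where "us' = map (\<lambda>j. (us @ 0 # vs) ! (j - 1)) ls"
    define vs' where "vs' = map (\<lambda>j. (us @ 0 # vs) ! (j - 1)) rs"
    have rb: "restrict_block (\<lambda>j. (us @ z # vs) ! (j - 1)) V = us' @ z # vs'" for z
    proof -
      have "map (\<lambda>j. (us @ z # vs) ! (j - 1)) ls = us'"
        unfolding us'_def using dist sV by (intro map_cong refl nth) auto
      moreover have "map (\<lambda>j. (us @ z # vs) ! (j - 1)) rs = vs'"
        unfolding vs'_def using dist sV by (intro map_cong refl nth) auto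
      ultimately show ?thesis by (simp add: restrict_block_def lr q_def)
    qed
    have T: "T z \<pi> = rec_cumulant \<phi> (us' @ z # vs') * R" for z
    proof -
      have "restrict_block (\<lambda>j. (us @ z # vs) ! (j - 1)) W = restrict_block (\<lambda>j. (us @ 0 # vs) ! (j - 1)) W"
        if "W \<in> \<pi> - {V}" for W
        using NC_block[of \<pi> n W] \<pi> that other[OF that]
        by (intro restrict_block_cong nth) auto
      then show ?thesis
        unfolding T_def prod.remove[OF fin V(1)] rb R_def
        by (metis (no_types, lifting) prod.cong)
    qed
    have "length us' + length vs' < length us + length vs"
    proof -
      have "length (sorted_list_of_set V) < n" using card_block_less[OF \<pi> V(1)] by simp
      then show ?thesis by (simp add: lr us'_def vs'_def n_def)
    qed
    then have IH: "rec_cumulant \<phi> (us' @ (x + y) # vs') =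
           rec_cumulant \<phi> (us' @ x # vs') + rec_cumulant \<phi> (us' @ y # vs')"
         "rec_cumulant \<phi> (us' @ scale c x # vs') = c * rec_cumulant \<phi> (us' @ x # vs')"
      using less[of us' vs'] by blast+
    show ?thesis unfolding T IH by (simp only: distrib_right mult.assoc simp_thms)
  qed
  have add: "(\<Sum>\<pi>\<in>NC n - {nc_top n}. T (x + y) \<pi>) =
      (\<Sum>\<pi>\<in>NC n - {nc_top n}. T x \<pi>) + (\<Sum>\<pi>\<in>NC n - {nc_top n}. T y \<pi>)"
    using * by (simp add: sum.distrib)
  have sc: "(\<Sum>\<pi>\<in>NC n - {nc_top n}. T (scale c x) \<pi>) = c * (\<Sum>\<pi>\<in>NC n - {nc_top n}. T x \<pi>)"
    using * by (simp add: sum_distrib_left)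
  show ?case
    unfolding rc add sc scale_mult_left scale_mult_right distrib_left distrib_right phi.add phi.scale
    by (simp add: right_diff_distrib)
qed

lemma complex_vector_space: "vector_space ((*) :: complex \<Rightarrow> complex \<Rightarrow> complex)"
  by unfold_locales (auto simp: algebra_simps)

theorem free_cumulants_rec_cumulant:
  assumes "nc_prob_space scale \<phi>"
  shows "free_cumulants scale \<phi> (rec_cumulant \<phi>)"
proof -
  interpret nc_prob_space scale \<phi> by fact
  have "Vector_Spaces.linear scale (*) (\<lambda>a. rec_cumulant \<phi> (us @ a # vs))" for us vs
    using rec_cumulant_linear[OF assms] complex_vector_space vector_space_axioms
    by (auto simp: Vector_Spaces.linear_iff)
  moreover have "\<phi> (prod_list (map a [1..<Suc n])) =
      (\<Sum>\<pi>\<in>NC n. \<Prod>V\<in>\<pi>. rec_cumulant \<phi> (restrict_block a V))" if n: "n \<ge> 1" for n a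
  proof -
    have rb: "restrict_block (\<lambda>j. map a [1..<Suc n] ! (j - 1)) V = restrict_block a V"
      if "\<pi> \<in> NC n" "V \<in> \<pi>" for \<pi> V
    proof (rule restrict_block_cong)
      fix v assume "v \<in> V"
      then have "1 \<le> v" "v \<le> n" using NC_block[OF that] by auto
      then show "map a [1..<Suc n] ! (v - 1) = a v"
        by (subst nth_map_upt) auto
    qed (use NC_block[OF that] in blast)
    have len: "length (map a [1..<Suc n]) = n" by simp
    have "rec_cumulant \<phi> (map a [1..<Suc n]) = \<phi> (prod_list (map a [1..<Suc n])) -
        (\<Sum>\<pi>\<in>NC n - {nc_top n}. \<Prod>V\<in>\<pi>. rec_cumulant \<phi> (restrict_block a V))"
      unfolding rec_cumulant.simps[of \<phi> "map a [1..<Suc n]"] len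
      by (intro arg_cong2[where f = "(-)"] refl sum.cong prod.cong arg_cong[where f = "rec_cumulant \<phi>"] rb) auto
    moreover have "rec_cumulant \<phi> (map a [1..<Suc n]) = (\<Prod>V\<in>nc_top n. rec_cumulant \<phi> (restrict_block a V))"
      by (simp add: nc_top_def restrict_block_full del: upt_Suc One_nat_def)
    ultimately show ?thesis
      using sum.remove[OF finite_NC nc_top_in_NC[OF n],
          of "\<lambda>\<pi>. \<Prod>V\<in>\<pi>. rec_cumulant \<phi> (restrict_block a V)"] by (simp add: diff_eq_eq del: upt_Suc)
  qed
  ultimately show ?thesis unfolding free_cumulants_def by blast
qed

theorem free_cumulants_unique:
  assumes "free_cumulants scale \<phi> k" "free_cumulants scale \<phi> k'" "as \<noteq> []"
  shows "k as = k' as"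
  using assms(3)
proof (induction "length as" arbitrary: as rule: less_induct)
  case less
  define n where "n = length as"
  define a where "a = (\<lambda>j. as ! (j - 1))"
  have n: "n \<ge> 1" using less.prems by (cases as) (auto simp: n_def)
  have as: "map a [1..<Suc n] = as"
    by (rule nth_equalityI) (auto simp: n_def a_def simp del: upt_Suc)
  have eq: "\<phi> (prod_list as) = h as + (\<Sum>\<pi>\<in>NC n - {nc_top n}. \<Prod>V\<in>\<pi>. h (restrict_block a V))"
    if "free_cumulants scale \<phi> h" for h
  proof -
    have "\<phi> (prod_list as) = (\<Sum>\<pi>\<in>NC n. \<Prod>V\<in>\<pi>. h (restrict_block a V))"
      using that n unfolding free_cumulants_def by (subst as[symmetric]) blast
    also have "\<dots> = (\<Prod>V\<in>nc_top n. h (restrict_block a V)) +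
        (\<Sum>\<pi>\<in>NC n - {nc_top n}. \<Prod>V\<in>\<pi>. h (restrict_block a V))"
      by (rule sum.remove[OF finite_NC nc_top_in_NC[OF n]])
    also have "(\<Prod>V\<in>nc_top n. h (restrict_block a V)) = h as"
      by (simp add: nc_top_def restrict_block_full as del: upt_Suc One_nat_def)
    finally show ?thesis .
  qed
  have "(\<Sum>\<pi>\<in>NC n - {nc_top n}. \<Prod>V\<in>\<pi>. k (restrict_block a V)) =
        (\<Sum>\<pi>\<in>NC n - {nc_top n}. \<Prod>V\<in>\<pi>. k' (restrict_block a V))"
  proof (intro sum.cong prod.cong refl less.hyps)
    fix \<pi> V assume \<pi>: "\<pi> \<in> NC n - {nc_top n}" and V: "V \<in> \<pi>"
    show "length (restrict_block a V) < length as" using card_block_less[OF \<pi> V] by (simp add: n_def)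
    have "V \<noteq> {}" "finite V" using \<pi> V NC_block[of \<pi> n V] by (auto simp: NC_def partition_on_def)
    then show "restrict_block a V \<noteq> []" by (simp add: restrict_block_def)
  qed
  with eq[OF assms(1)] eq[OF assms(2)] show ?case by simp
qed

end

theory Submission
  imports Defs "HOL-Library.FuncSet"
begin

text \<open>
  Since \<open>\<phi> \<circ> E = \<phi>\<close>, this is Moebius inversion in \<open>NC(n)\<close>. A noncrossing partition
  \<open>\<pi> \<le> \<sigma>\<close> is the same as a choice of a noncrossing partition of every block of \<open>\<sigma>\<close>, so the
  moment-cumulant formula extends multiplicatively to \<open>\<phi>\<^sub>\<sigma> = (\<Sum>\<pi>\<le>\<sigma>. k\<^sub>\<pi>)\<close>, where \<open>\<phi>\<^sub>\<sigma>\<close> and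
  \<open>k\<^sub>\<pi>\<close> are the products of moments and cumulants over the blocks. Inverting and evaluating at
  \<open>1\<^sub>n\<close> gives the cumulants; substituting them into the moment-cumulant formula gives the moments.
\<close>

section \<open>Moebius inversion in \<open>NC n\<close>\<close>

text \<open>The recursion chooses the value at the upper end of a nontrivial interval so that the
  sum over the interval cancels. In the incidence algebra this is \<mu> * \<zeta> =
  \<delta>.\<close>

lemma sum_nc_moebius:
  assumes "\<pi> \<in> NC n" "\<sigma> \<in> NC n"
  shows "(\<Sum>\<tau> | \<tau> \<in> NC n \<and> refines {1..n} \<pi> \<tau> \<and> refines {1..n} \<tau> \<sigma>. nc_moebius n \<pi> \<tau>) =
    (if \<pi> = \<sigma> then 1 else 0)"
proof (cases "refines {1..n} \<pi> \<sigma>")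
  case True
  let ?I = "{\<tau>. \<tau> \<in> NC n \<and> refines {1..n} \<pi> \<tau> \<and> refines {1..n} \<tau> \<sigma>}"
  have fin: "finite ?I" using finite_NC[of n] by auto
  have mem: "\<sigma> \<in> ?I" using True assms refines_refl by (auto simp: NC_def)
  \<comment> \<open>Splitting off \<sigma> leaves exactly the index set of the recursion for
    \<open>nc_moebius n \<pi> \<sigma>\<close>.\<close>
  have rest: "?I - {\<sigma>} = {\<tau> \<in> NC n. refines {1..n} \<pi> \<tau> \<and> refines {1..n} \<tau> \<sigma> \<and> \<tau> \<noteq> \<sigma>}"
    by auto
  show ?thesis
  proof (cases "\<pi> = \<sigma>")
    case True
    then have empty: "?I - {\<sigma>} = {}" using refines_asym by blast
    show ?thesis
      unfolding sum.remove[OF fin mem] empty using True by (simp add: nc_moebius.simps)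
  next
    case False
    show ?thesis
      unfolding sum.remove[OF fin mem] rest
      by (subst nc_moebius.simps) (use True False in simp)
  qed
next
  case False
  then have empty: "{\<tau>. \<tau> \<in> NC n \<and> refines {1..n} \<pi> \<tau> \<and> refines {1..n} \<tau> \<sigma>} = {}"
    using refines_trans by blast
  have "\<pi> \<noteq> \<sigma>" using False assms refines_refl by (auto simp: NC_def)
  then show ?thesis unfolding empty by simp
qed

text \<open>The recursion gives \<mu> * \<zeta> = \<delta>, while substituting directly into the
  inversion formula would call for \<zeta> * \<mu> = \<delta>. Injectivity of summation over
  down-sets takes its place: by induction on the size of the down-set, all terms strictly below
  \<sigma> agree, and this leaves the term at \<sigma>.\<close>

lemma sum_refines_unique:
  fixes g h :: "nat set set \<Rightarrow> 'a::ab_group_add"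
  assumes eq: "\<And>\<sigma>. \<sigma> \<in> NC n \<Longrightarrow>
      (\<Sum>\<tau> | \<tau> \<in> NC n \<and> refines {1..n} \<tau> \<sigma>. g \<tau>) = (\<Sum>\<tau> | \<tau> \<in> NC n \<and> refines {1..n} \<tau> \<sigma>. h \<tau>)"
    and "\<sigma> \<in> NC n"
  shows "g \<sigma> = h \<sigma>"
  using assms(2)
proof (induction "card {\<tau>. \<tau> \<in> NC n \<and> refines {1..n} \<tau> \<sigma>}" arbitrary: \<sigma> rule: less_induct)
  case less
  let ?D = "\<lambda>\<sigma>. {\<tau>. \<tau> \<in> NC n \<and> refines {1..n} \<tau> \<sigma>}"
  have fin: "finite (?D \<sigma>)" for \<sigma> using finite_NC[of n] by auto
  have mem: "\<sigma> \<in> ?D \<sigma>" using less.prems refines_refl by (auto simp: NC_def)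
  have "sum g (?D \<sigma> - {\<sigma>}) = sum h (?D \<sigma> - {\<sigma>})"
  proof (rule sum.cong[OF refl])
    fix \<tau> assume \<tau>: "\<tau> \<in> ?D \<sigma> - {\<sigma>}"
    have "?D \<tau> \<subseteq> ?D \<sigma>" using \<tau> refines_trans by blast
    moreover have "\<sigma> \<notin> ?D \<tau>" using \<tau> refines_asym by blast
    ultimately have "?D \<tau> \<subset> ?D \<sigma>" using mem by blast
    then have "card (?D \<tau>) < card (?D \<sigma>)" by (rule psubset_card_mono[OF fin])
    then show "g \<tau> = h \<tau>" using less.hyps \<tau> by blast
  qed
  then show ?case
    using eq[OF less.prems] unfolding sum.remove[OF fin mem] by simp
qed

lemma nc_moebius_inversion:
  fixes f g :: "nat set set \<Rightarrow> 'a::comm_ring_1"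
  assumes f: "\<And>\<sigma>. \<sigma> \<in> NC n \<Longrightarrow> f \<sigma> = (\<Sum>\<tau> | \<tau> \<in> NC n \<and> refines {1..n} \<tau> \<sigma>. g \<tau>)"
    and "\<sigma> \<in> NC n"
  shows "g \<sigma> = (\<Sum>\<pi> | \<pi> \<in> NC n \<and> refines {1..n} \<pi> \<sigma>. f \<pi> * of_int (nc_moebius n \<pi> \<sigma>))"
\<comment> \<open>It suffices to compare sums over down-sets. For \<open>g\<close> the sum is
  \<open>f \<sigma>\<close> by hypothesis; for the Moebius expression it collapses to
  \<open>f \<sigma>\<close> once the two summations are interchanged.\<close>
proof (rule sum_refines_unique[OF _ assms(2)])
  fix \<sigma> assume \<sigma>: "\<sigma> \<in> NC n"
  have sets: "finite {\<tau>. \<tau> \<in> NC n \<and> P \<tau>}" for P using finite_NC[of n] by auto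
  have "(\<Sum>\<tau> | \<tau> \<in> NC n \<and> refines {1..n} \<tau> \<sigma>.
          \<Sum>\<pi> | \<pi> \<in> NC n \<and> refines {1..n} \<pi> \<tau>. f \<pi> * of_int (nc_moebius n \<pi> \<tau>)) =
        (\<Sum>\<tau> | \<tau> \<in> NC n \<and> refines {1..n} \<tau> \<sigma>.
          \<Sum>\<pi> | \<pi> \<in> NC n \<and> refines {1..n} \<pi> \<tau>. of_int (nc_moebius n \<pi> \<tau>) * f \<pi>)"
    by (simp add: mult.commute)
  also have "\<dots> = (\<Sum>\<pi>\<in>NC n. \<Sum>\<tau> | \<tau> \<in> {\<tau>. \<tau> \<in> NC n \<and> refines {1..n} \<tau> \<sigma>} \<and> refines {1..n} \<pi> \<tau>.
      of_int (nc_moebius n \<pi> \<tau>) * f \<pi>)"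
    by (rule sum.swap_restrict[OF sets finite_NC])
  also have "\<dots> = (\<Sum>\<pi>\<in>NC n.
      of_int (\<Sum>\<tau> | \<tau> \<in> NC n \<and> refines {1..n} \<pi> \<tau> \<and> refines {1..n} \<tau> \<sigma>. nc_moebius n \<pi> \<tau>) * f \<pi>)"
    by (intro sum.cong refl) (auto simp: sum_distrib_right intro!: sum.cong)
  also have "\<dots> = (\<Sum>\<pi>\<in>NC n. if \<pi> = \<sigma> then f \<pi> else 0)"
    by (intro sum.cong refl) (subst sum_nc_moebius, use \<sigma> in auto)
  also have "\<dots> = f \<sigma>" using \<sigma> finite_NC[of n] by simp
  finally show "(\<Sum>\<tau> | \<tau> \<in> NC n \<and> refines {1..n} \<tau> \<sigma>. g \<tau>) =
      (\<Sum>\<tau> | \<tau> \<in> NC n \<and> refines {1..n} \<tau> \<sigma>.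
        \<Sum>\<pi> | \<pi> \<in> NC n \<and> refines {1..n} \<pi> \<tau>. f \<pi> * of_int (nc_moebius n \<pi> \<tau>))"
    using f[OF \<sigma>] by simp
qed

section \<open>Noncrossing partitions of arbitrary sets of naturals and their relabelling\<close>

lemma noncrossingI:
  assumes "\<And>V W a b c d. V \<in> \<pi> \<Longrightarrow> W \<in> \<pi> \<Longrightarrow> a \<in> V \<Longrightarrow> b \<in> W \<Longrightarrow> c \<in> V \<Longrightarrow> d \<in> W \<Longrightarrow>
    a < b \<Longrightarrow> b < c \<Longrightarrow> c < d \<Longrightarrow> V = W"
  shows "noncrossing \<pi>"
  unfolding noncrossing_def
proof (intro ballI impI notI)
  fix V W assume VW: "V \<in> \<pi>" "W \<in> \<pi>" "V \<noteq> W"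
    and "\<exists>a\<in>V. \<exists>b\<in>W. \<exists>c\<in>V. \<exists>d\<in>W. a < b \<and> b < c \<and> c < d"
  then obtain a b c d where "a \<in> V" "b \<in> W" "c \<in> V" "d \<in> W" "a < b" "b < c" "c < d"
    by (elim bexE conjE)
  then have "V = W" by (rule assms[OF VW(1,2)])
  then show False using VW(3) by simp
qed

lemma noncrossingD:
  assumes "noncrossing \<pi>" "V \<in> \<pi>" "W \<in> \<pi>" "a \<in> V" "b \<in> W" "c \<in> V" "d \<in> W"
    "a < b" "b < c" "c < d"
  shows "V = W"
proof (rule ccontr)
  assume ne: "V \<noteq> W"
  have "\<not> (\<exists>a\<in>V. \<exists>b\<in>W. \<exists>c\<in>V. \<exists>d\<in>W. a < b \<and> b < c \<and> c < d)"
    using bspec[OF bspec[OF assms(1)[unfolded noncrossing_def] assms(2)] assms(3)] ne by (rule mp)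
  moreover have "\<exists>a\<in>V. \<exists>b\<in>W. \<exists>c\<in>V. \<exists>d\<in>W. a < b \<and> b < c \<and> c < d"
    by (rule bexI[OF _ assms(4)], rule bexI[OF _ assms(5)], rule bexI[OF _ assms(6)],
        rule bexI[OF _ assms(7)]) (intro conjI assms(8-10))
  ultimately show False by (rule notE)
qed

text \<open>A block of a partition is itself to be partitioned, so ground sets other than
  \<open>{1..n}\<close> are needed.\<close>

definition NC_on :: "nat set \<Rightarrow> nat set set set" where
  "NC_on S = {\<pi>. partition_on S \<pi> \<and> noncrossing \<pi>}"

lemma NC_eq_NC_on: "NC n = NC_on {1..n}"
  by (simp add: NC_def NC_on_def)

lemma finite_NC_on: "finite S \<Longrightarrow> finite (NC_on S)"
  using finitely_many_partition_on[of S] by (simp add: NC_on_def)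

lemma noncrossing_subset:
  assumes "noncrossing \<sigma>" "\<pi> \<subseteq> \<sigma>"
  shows "noncrossing \<pi>"
proof (rule noncrossingI)
  fix V W a b c d
  assume "V \<in> \<pi>" "W \<in> \<pi>" and abcd: "a \<in> V" "b \<in> W" "c \<in> V" "d \<in> W" "a < b" "b < c" "c < d"
  with assms(2) have "V \<in> \<sigma>" "W \<in> \<sigma>" by auto
  then show "V = W" using abcd by (rule noncrossingD[OF assms(1)])
qed

text \<open>A strictly increasing map also reflects the order on \<open>S\<close>, so a crossing
  among the image blocks pulls back to a crossing in \<pi>.\<close>

lemma image_in_NC_on:
  assumes f: "strict_mono_on S f" and \<pi>: "\<pi> \<in> NC_on S"
  shows "(`) f ` \<pi> \<in> NC_on (f ` S)"
proof -
  have p: "partition_on S \<pi>" "noncrossing \<pi>" using \<pi> by (auto simp: NC_on_def)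
  have inj: "inj_on f S" using f by (rule strict_mono_on_imp_inj_on)
  have sub: "V \<subseteq> S" if "V \<in> \<pi>" for V using p that by (auto simp: partition_on_def)
  have less: "a < b" if "f a < f b" "a \<in> S" "b \<in> S" for a b
    using that strict_mono_onD[OF f, of b a] by (metis less_asym linorder_neqE_nat)
  \<comment> \<open>The library rule for images of partitions discards the empty set; there is none
    here, since blocks are nonempty.\<close>
  have "(`) f ` \<pi> - {{}} = (`) f ` \<pi>" using p by (auto simp: partition_on_def)
  then have "partition_on (f ` S) ((`) f ` \<pi>)"
    using partition_on_inj_image[OF p(1) inj] by simp
  moreover have "noncrossing ((`) f ` \<pi>)"
  proof (rule noncrossingI)
    fix V' W' a' b' c' d' assume "V' \<in> (`) f ` \<pi>" "W' \<in> (`) f ` \<pi>"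
      and abcd': "a' \<in> V'" "b' \<in> W'" "c' \<in> V'" "d' \<in> W'" "a' < b'" "b' < c'" "c' < d'"
    then obtain V W where VW: "V \<in> \<pi>" "W \<in> \<pi>" "V' = f ` V" "W' = f ` W" by blast
    from abcd' VW obtain a b c d where abcd: "a \<in> V" "b \<in> W" "c \<in> V" "d \<in> W"
      "a' = f a" "b' = f b" "c' = f c" "d' = f d" by blast
    then have S: "a \<in> S" "b \<in> S" "c \<in> S" "d \<in> S" using sub VW(1,2) by auto
    have "a < b" "b < c" "c < d"
      using less[OF _ S(1,2)] less[OF _ S(2,3)] less[OF _ S(3,4)] abcd(5-8) abcd'(5-7) by simp_all
    then have "V = W" by (rule noncrossingD[OF p(2) VW(1,2) abcd(1-4)])
    then show "V' = W'" using VW by simp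
  qed
  ultimately show ?thesis by (simp add: NC_on_def)
qed

lemma image_image_eq_self:
  assumes "\<And>x. x \<in> A \<Longrightarrow> g (f x) = x"
  shows "g ` f ` A = A"
  unfolding image_image using assms by simp

text \<open>The inverse of \<open>f\<close> on its image is strictly increasing too, so relabelling
  back stays within noncrossing partitions.\<close>

lemma bij_betw_NC_on:
  assumes f: "strict_mono_on S f"
  shows "bij_betw ((`) ((`) f)) (NC_on S) (NC_on (f ` S))"
proof -
  have inj: "inj_on f S" using f by (rule strict_mono_on_imp_inj_on)
  define g where "g = the_inv_into S f"
  have gf: "g (f a) = a" if "a \<in> S" for a using that inj by (simp add: g_def the_inv_into_f_f)
  have fg: "f (g b) = b" if "b \<in> f ` S" for b
    using that inj by (simp add: g_def f_the_inv_into_f)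
  have gS: "g ` f ` S = S" using gf by (rule image_image_eq_self)
  have g: "strict_mono_on (f ` S) g"
  proof (rule strict_mono_onI)
    fix r s assume "r \<in> f ` S" "s \<in> f ` S" "r < s"
    then show "g r < g s"
      using gf strict_mono_onD[OF f] by (metis imageE less_asym linorder_neqE_nat)
  qed
  show ?thesis
  proof (rule bij_betw_byWitness[where f' = "(`) ((`) g)"])
    show "\<forall>\<pi>\<in>NC_on S. (`) g ` (`) f ` \<pi> = \<pi>"
    \<comment> \<open>The rule fires twice: first for the blocks of \<pi>, then for the points of a
      block.\<close>
    proof (intro ballI image_image_eq_self)
      fix \<pi> V a assume "\<pi> \<in> NC_on S" "V \<in> \<pi>" "a \<in> V"
      then have "a \<in> S" by (auto simp: NC_on_def partition_on_def)
      then show "g (f a) = a" by (rule gf)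
    qed
    show "\<forall>\<pi>\<in>NC_on (f ` S). (`) f ` (`) g ` \<pi> = \<pi>"
    proof (intro ballI image_image_eq_self)
      fix \<pi> V b assume "\<pi> \<in> NC_on (f ` S)" "V \<in> \<pi>" "b \<in> V"
      then have "b \<in> f ` S" unfolding NC_on_def partition_on_def by blast
      then show "f (g b) = b" by (rule fg)
    qed
    show "(`) ((`) f) ` NC_on S \<subseteq> NC_on (f ` S)" using image_in_NC_on[OF f] by blast
    show "(`) ((`) g) ` NC_on (f ` S) \<subseteq> NC_on S" using image_in_NC_on[OF g] unfolding gS by blast
  qed
qed

section \<open>Blocks as increasing tuples\<close>

lemma block_nth_strict_mono: "strict_mono_on {1..card V} (block_nth V)"
proof (rule strict_mono_onI)
  fix r s assume "r \<in> {1..card V}" "s \<in> {1..card V}" "r < s"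
  then show "block_nth V r < block_nth V s"
    unfolding block_nth_def
    by (intro sorted_wrt_nth_less[OF strict_sorted_list_of_set]) auto
qed

lemma map_block_nth: "map (block_nth V) [1..<Suc (card V)] = sorted_list_of_set V"
  by (rule nth_equalityI) (auto simp: block_nth_def simp del: upt_Suc)

lemma block_nth_image:
  assumes "finite V"
  shows "block_nth V ` {1..card V} = V"
proof -
  have "set (map (block_nth V) [1..<Suc (card V)]) = V"
    unfolding map_block_nth using assms by simp
  then show ?thesis by (simp only: set_map set_upt atLeastLessThanSuc_atLeastAtMost)
qed

text \<open>An increasing map commutes with sorting, so relabelling a block does not permute the
  entries of its tuple.\<close>

lemma restrict_block_image:
  assumes "strict_mono_on S f" "finite S" "W \<subseteq> S"
  shows "restrict_block a (f ` W) = restrict_block (a \<circ> f) W"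
proof -
  have W: "finite W" using assms finite_subset by blast
  have "sorted_wrt (<) (map f (sorted_list_of_set W))"
    unfolding sorted_wrt_map
    using strict_sorted_list_of_set[of W]
    by (rule sorted_wrt_mono_rel[rotated]) (use assms W in \<open>auto intro: strict_mono_onD\<close>)
  then have "sorted_list_of_set (f ` W) = map f (sorted_list_of_set W)"
    using W by (intro strict_sorted_equal) auto
  then show ?thesis by (simp add: restrict_block_def)
qed

text \<open>Relabelling along \<open>block_nth V\<close> turns partitions of a block into the
  standard form \<open>NC (card V)\<close>, in which the moment-cumulant formula is stated.\<close>

lemma sum_NC_on_block:
  fixes h :: "'a list \<Rightarrow> 'b::comm_semiring_1"
  assumes V: "finite V"
  shows "(\<Sum>\<pi>\<in>NC_on V. \<Prod>W\<in>\<pi>. h (restrict_block a W)) =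
    (\<Sum>\<theta>\<in>NC (card V). \<Prod>W\<in>\<theta>. h (restrict_block (a \<circ> block_nth V) W))"
proof -
  let ?f = "block_nth V" and ?S = "{1..card V}"
  note mono = block_nth_strict_mono[of V]
  have bij: "bij_betw ((`) ((`) ?f)) (NC_on ?S) (NC_on V)"
    using bij_betw_NC_on[OF mono] unfolding block_nth_image[OF V] .
  have "(\<Sum>\<pi>\<in>NC_on V. \<Prod>W\<in>\<pi>. h (restrict_block a W)) =
      (\<Sum>\<theta>\<in>NC_on ?S. \<Prod>W\<in>(`) ?f ` \<theta>. h (restrict_block a W))"
    by (rule sum.reindex_bij_betw[OF bij, symmetric])
  also have "\<dots> = (\<Sum>\<theta>\<in>NC_on ?S. \<Prod>W\<in>\<theta>. h (restrict_block (a \<circ> ?f) W))"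
  proof (rule sum.cong[OF refl])
    fix \<theta> assume "\<theta> \<in> NC_on ?S"
    then have sub: "\<theta> \<subseteq> Pow ?S" by (auto simp: NC_on_def partition_on_def)
    \<comment> \<open>Distinct blocks have distinct images, so reindexing the product loses no
      factor.\<close>
    have "inj_on ((`) ?f) \<theta>"
      using inj_on_image_Pow[OF strict_mono_on_imp_inj_on[OF mono]] sub by (rule inj_on_subset)
    then have "(\<Prod>W\<in>(`) ?f ` \<theta>. h (restrict_block a W)) = (\<Prod>W\<in>\<theta>. h (restrict_block a (?f ` W)))"
      by (simp add: prod.reindex)
    also have "\<dots> = (\<Prod>W\<in>\<theta>. h (restrict_block (a \<circ> ?f) W))"
      using sub by (intro prod.cong refl arg_cong[where f = h] restrict_block_image[OF mono]) auto
    finally show "(\<Prod>W\<in>(`) ?f ` \<theta>. h (restrict_block a W)) =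
        (\<Prod>W\<in>\<theta>. h (restrict_block (a \<circ> ?f) W))" .
  qed
  finally show ?thesis by (simp add: NC_eq_NC_on)
qed

section \<open>Partitions below \<sigma> as choices of a partition on each block of \<sigma>\<close>

text \<open>Pieces of different blocks of \<sigma> cannot cross because those blocks do not, and
  pieces of the same block do not cross by the choice of \<open>g V\<close>. The last claim recovers
  \<open>g\<close> from its union.\<close>

lemma Union_NC_on_refines:
  assumes \<sigma>: "\<sigma> \<in> NC_on S" and g: "g \<in> PiE \<sigma> NC_on"
  shows "\<Union>(g ` \<sigma>) \<in> NC_on S" "refines S (\<Union>(g ` \<sigma>)) \<sigma>"
    "V \<in> \<sigma> \<Longrightarrow> {W \<in> \<Union>(g ` \<sigma>). W \<subseteq> V} = g V"
proof -
  have \<sigma>p: "partition_on S \<sigma>" "noncrossing \<sigma>" using \<sigma> by (auto simp: NC_on_def)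
  have gV: "partition_on V (g V)" "noncrossing (g V)" if "V \<in> \<sigma>" for V
    using g that by (auto simp: NC_on_def PiE_def Pi_def)
  have sub: "W \<subseteq> V" "W \<noteq> {}" if "V \<in> \<sigma>" "W \<in> g V" for V W
    using gV[OF that(1)] that(2) by (auto simp: partition_on_def)
  have disj: "V = V'" if "V \<in> \<sigma>" "V' \<in> \<sigma>" "x \<in> V" "x \<in> V'" for V V' x
    using \<sigma>p that by (auto simp: partition_on_def disjoint_def)
  have p: "partition_on S (\<Union>(g ` \<sigma>))"
  proof (rule partition_onI)
    have "\<Union>(g V) = V" if "V \<in> \<sigma>" for V using gV[OF that] by (simp add: partition_on_def)
    then have "\<Union>(\<Union>(g ` \<sigma>)) = \<Union>\<sigma>" by fastforce
    then show "\<Union>(\<Union>(g ` \<sigma>)) = S" using \<sigma>p by (simp add: partition_on_def)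
    show "{} \<notin> \<Union>(g ` \<sigma>)" using sub by blast
    fix W W' assume "W \<in> \<Union>(g ` \<sigma>)" "W' \<in> \<Union>(g ` \<sigma>)" and ne: "W \<noteq> W'"
    then obtain V V' where V: "V \<in> \<sigma>" "W \<in> g V" "V' \<in> \<sigma>" "W' \<in> g V'" by blast
    show "disjnt W W'"
    proof (cases "V = V'")
      case True
      then show ?thesis using gV[OF V(1)] V ne by (auto simp: partition_on_def disjoint_def disjnt_def)
    next
      case False
      then show ?thesis using disj sub V unfolding disjnt_iff by blast
    qed
  qed
  have "noncrossing (\<Union>(g ` \<sigma>))"
  proof (rule noncrossingI)
    fix W W' a b c d assume "W \<in> \<Union>(g ` \<sigma>)" "W' \<in> \<Union>(g ` \<sigma>)"
      and abcd: "a \<in> W" "b \<in> W'" "c \<in> W" "d \<in> W'" "a < b" "b < c" "c < d"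
    then obtain V V' where V: "V \<in> \<sigma>" "W \<in> g V" "V' \<in> \<sigma>" "W' \<in> g V'" by blast
    \<comment> \<open>A crossing of \<open>W\<close> and \<open>W'\<close> is also a pattern a < b <
      c < d in \<open>V\<close> and \<open>V'\<close>, which forces \<open>V = V'\<close>.\<close>
    have "a \<in> V" "b \<in> V'" "c \<in> V" "d \<in> V'"
      using abcd(1-4) sub(1)[OF V(1,2)] sub(1)[OF V(3,4)] by auto
    then have "V = V'" using noncrossingD[OF \<sigma>p(2) V(1,3)] abcd(5-7) by blast
    then show "W = W'" using noncrossingD[OF gV(2)[OF V(1)] V(2) _ abcd] V(4) by simp
  qed
  with p show "\<Union>(g ` \<sigma>) \<in> NC_on S" by (simp add: NC_on_def)
  show "refines S (\<Union>(g ` \<sigma>)) \<sigma>"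
    using p \<sigma>p sub unfolding refines_def by blast
  show "{W \<in> \<Union>(g ` \<sigma>). W \<subseteq> V} = g V" if V: "V \<in> \<sigma>"
  proof
    show "g V \<subseteq> {W \<in> \<Union>(g ` \<sigma>). W \<subseteq> V}" using V sub by blast
    show "{W \<in> \<Union>(g ` \<sigma>). W \<subseteq> V} \<subseteq> g V"
    proof
      fix W assume "W \<in> {W \<in> \<Union>(g ` \<sigma>). W \<subseteq> V}"
      then obtain V' where V': "V' \<in> \<sigma>" "W \<in> g V'" "W \<subseteq> V" by blast
      \<comment> \<open>A common point of \<open>V\<close> and \<open>V'\<close> identifies these
        blocks; the nonempty piece \<open>W\<close> supplies one.\<close>
      then obtain x where "x \<in> W" using sub by blast
      then have "V = V'" using V V' sub[OF V'(1,2)] disj by blast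
      then show "W \<in> g V" using V' by simp
    qed
  qed
qed

lemma bij_betw_Union_NC_on:
  assumes \<sigma>: "\<sigma> \<in> NC_on S"
  shows "bij_betw (\<lambda>g. \<Union>(g ` \<sigma>)) (PiE \<sigma> NC_on) {\<pi> \<in> NC_on S. refines S \<pi> \<sigma>}"
\<comment> \<open>Cutting \<pi> along the blocks of \<sigma> inverts the union. The abstraction is
  restricted to \<sigma> because members of \<open>PiE\<close> are \<open>undefined\<close>
  elsewhere.\<close>
proof (rule bij_betw_byWitness[where f' = "\<lambda>\<pi>. \<lambda>V\<in>\<sigma>. {W \<in> \<pi>. W \<subseteq> V}"])
  show "\<forall>g\<in>PiE \<sigma> NC_on. (\<lambda>V\<in>\<sigma>. {W \<in> \<Union>(g ` \<sigma>). W \<subseteq> V}) = g"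
  proof
    fix g assume g: "g \<in> PiE \<sigma> NC_on"
    show "(\<lambda>V\<in>\<sigma>. {W \<in> \<Union>(g ` \<sigma>). W \<subseteq> V}) = g"
      using Union_NC_on_refines(3)[OF \<sigma> g] g
      by (intro ext) (auto simp: restrict_def PiE_def extensional_def)
  qed
  \<comment> \<open>Refinement places every block of \<pi> inside some block of \<sigma>, so the
    cutting loses none.\<close>
  show "\<forall>\<pi>\<in>{\<pi> \<in> NC_on S. refines S \<pi> \<sigma>}. \<Union>((\<lambda>V\<in>\<sigma>. {W \<in> \<pi>. W \<subseteq> V}) ` \<sigma>) = \<pi>"
    by (force simp: refines_def)
  show "(\<lambda>g. \<Union>(g ` \<sigma>)) ` PiE \<sigma> NC_on \<subseteq> {\<pi> \<in> NC_on S. refines S \<pi> \<sigma>}"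
    using Union_NC_on_refines(1,2)[OF \<sigma>] by blast
  show "(\<lambda>\<pi>. \<lambda>V\<in>\<sigma>. {W \<in> \<pi>. W \<subseteq> V}) ` {\<pi> \<in> NC_on S. refines S \<pi> \<sigma>} \<subseteq> PiE \<sigma> NC_on"
  proof (rule image_subsetI, rule restrict_PiE_iff[THEN iffD2], rule ballI)
    fix \<pi> V assume \<pi>: "\<pi> \<in> {\<pi> \<in> NC_on S. refines S \<pi> \<sigma>}" and V: "V \<in> \<sigma>"
    \<comment> \<open>A block of \<pi> that meets \<open>V\<close> lies inside \<open>V\<close>, so
      the selected blocks cover \<open>V\<close>.\<close>
    then have "partition_on V {W \<in> \<pi>. W \<subseteq> V}" using refines_obtains_subset by blast
    moreover have "noncrossing {W \<in> \<pi>. W \<subseteq> V}"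
      using \<pi> by (auto simp: NC_on_def intro: noncrossing_subset)
    ultimately show "{W \<in> \<pi>. W \<subseteq> V} \<in> NC_on V" by (simp add: NC_on_def)
  qed
qed

text \<open>Distributing the product over the sums gives a sum over choice functions in
  \<open>PiE \<sigma> NC_on\<close>, which the bijection with the down-set of \<sigma> reindexes.
  This is what makes the extension to \<phi>_\<sigma> multiplicative.\<close>

lemma prod_sum_NC_on:
  fixes h :: "nat set \<Rightarrow> 'a::comm_semiring_1"
  assumes S: "finite S" and \<sigma>: "\<sigma> \<in> NC_on S"
  shows "(\<Prod>V\<in>\<sigma>. \<Sum>\<pi>\<in>NC_on V. \<Prod>W\<in>\<pi>. h W) = (\<Sum>\<pi> | \<pi> \<in> NC_on S \<and> refines S \<pi> \<sigma>. \<Prod>W\<in>\<pi>. h W)"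
proof -
  have \<sigma>p: "partition_on S \<sigma>" using \<sigma> by (simp add: NC_on_def)
  have fin\<sigma>: "finite \<sigma>" by (rule finite_elements[OF S \<sigma>p])
  have finV: "finite V" if "V \<in> \<sigma>" for V
    using \<sigma>p that S by (metis Union_upper finite_subset partition_onD1)
  have "(\<Prod>V\<in>\<sigma>. \<Sum>\<pi>\<in>NC_on V. \<Prod>W\<in>\<pi>. h W) = (\<Sum>g\<in>PiE \<sigma> NC_on. \<Prod>V\<in>\<sigma>. \<Prod>W\<in>g V. h W)"
    by (rule prod_sum_PiE[OF fin\<sigma> finite_NC_on[OF finV]])
  also have "\<dots> = (\<Sum>g\<in>PiE \<sigma> NC_on. \<Prod>W\<in>\<Union>(g ` \<sigma>). h W)"
  proof (rule sum.cong[OF refl])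
    fix g assume "g \<in> PiE \<sigma> NC_on"
    then have gV: "partition_on V (g V)" if "V \<in> \<sigma>" for V
      using that by (auto simp: NC_on_def PiE_def Pi_def)
    show "(\<Prod>V\<in>\<sigma>. \<Prod>W\<in>g V. h W) = (\<Prod>W\<in>\<Union>(g ` \<sigma>). h W)"
    proof (rule prod.UNION_disjoint[symmetric, OF fin\<sigma>])
      show "\<forall>V\<in>\<sigma>. finite (g V)" using gV finV finite_elements by blast
      \<comment> \<open>A shared piece would be a nonempty subset of two disjoint blocks; hence the
        union counts each factor once.\<close>
      show "\<forall>V\<in>\<sigma>. \<forall>V'\<in>\<sigma>. V \<noteq> V' \<longrightarrow> g V \<inter> g V' = {}"
      proof (intro ballI impI equals0I)
        fix V V' W assume V: "V \<in> \<sigma>" "V' \<in> \<sigma>" "V \<noteq> V'" and "W \<in> g V \<inter> g V'"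
        then have "W \<noteq> {}" "W \<subseteq> V" "W \<subseteq> V'"
          using gV[OF V(1)] gV[OF V(2)] by (auto simp: partition_on_def)
        then show False using disjointD[OF partition_onD2[OF \<sigma>p] V] by blast
      qed
    qed
  qed
  also have "\<dots> = (\<Sum>\<pi> | \<pi> \<in> NC_on S \<and> refines S \<pi> \<sigma>. \<Prod>W\<in>\<pi>. h W)"
    by (rule sum.reindex_bij_betw[OF bij_betw_Union_NC_on[OF \<sigma>]])
  finally show ?thesis .
qed

section \<open>Inverting the moment-cumulant formula\<close>

text \<open>The formula is given for the indices 1, ..., n only; applying it to the sequence
  \<open>a \<circ> block_nth V\<close> and relabelling back yields it on \<open>V\<close>.
  Nonemptiness of \<open>V\<close> provides the bound \<open>card V \<ge> 1\<close>.\<close>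

lemma free_cumulants_block:
  assumes k: "free_cumulants scale \<phi> k" and V: "finite V" "V \<noteq> {}"
  shows "\<phi> (prod_list (restrict_block a V)) = (\<Sum>\<pi>\<in>NC_on V. \<Prod>W\<in>\<pi>. k (restrict_block a W))"
proof -
  have "card V \<ge> 1" using V by (simp add: Suc_le_eq card_gt_0_iff)
  then have "\<phi> (prod_list (map (a \<circ> block_nth V) [1..<Suc (card V)])) =
      (\<Sum>\<theta>\<in>NC (card V). \<Prod>W\<in>\<theta>. k (restrict_block (a \<circ> block_nth V) W))"
    using k unfolding free_cumulants_def by blast
  then show ?thesis
    by (simp only: sum_NC_on_block[OF V(1)] restrict_block_def[of a V] map_block_nth flip: map_map)
qed

theorem free_cumulants_moebius:
  assumes k: "free_cumulants scale \<phi> k" and n: "n \<ge> 1"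
  shows "k (map a [1..<Suc n]) =
    (\<Sum>\<pi>\<in>NC n. (\<Prod>V\<in>\<pi>. \<phi> (prod_list (restrict_block a V))) * of_int (nc_moebius n \<pi> (nc_top n)))"
proof -
  have "(\<Prod>V\<in>nc_top n. k (restrict_block a V)) =
    (\<Sum>\<pi> | \<pi> \<in> NC n \<and> refines {1..n} \<pi> (nc_top n).
      (\<Prod>V\<in>\<pi>. \<phi> (prod_list (restrict_block a V))) * of_int (nc_moebius n \<pi> (nc_top n)))"
  \<comment> \<open>Here \<open>f\<close> is the product of moments over the blocks and
    \<open>g\<close> the product of cumulants. The relation between them comes from multiplying the
    formulas for the single blocks of \<sigma>.\<close>
  proof (rule nc_moebius_inversion[OF _ nc_top_in_NC[OF n]])
    fix \<sigma> assume \<sigma>: "\<sigma> \<in> NC n"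
    have "(\<Prod>V\<in>\<sigma>. \<phi> (prod_list (restrict_block a V))) =
        (\<Prod>V\<in>\<sigma>. \<Sum>\<pi>\<in>NC_on V. \<Prod>W\<in>\<pi>. k (restrict_block a W))"
      using NC_block[OF \<sigma>] \<sigma>
      by (intro prod.cong refl free_cumulants_block[OF k]) (auto simp: NC_def partition_on_def)
    also have "\<dots> = (\<Sum>\<tau> | \<tau> \<in> NC n \<and> refines {1..n} \<tau> \<sigma>. \<Prod>V\<in>\<tau>. k (restrict_block a V))"
      using \<sigma> unfolding NC_eq_NC_on by (intro prod_sum_NC_on) auto
    finally show "(\<Prod>V\<in>\<sigma>. \<phi> (prod_list (restrict_block a V))) =
        (\<Sum>\<tau> | \<tau> \<in> NC n \<and> refines {1..n} \<tau> \<sigma>. \<Prod>V\<in>\<tau>. k (restrict_block a V))" .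
  qed
  \<comment> \<open>At 1_n the down-set is all of \<open>NC n\<close>, and the product of cumulants
    has the single factor k_n.\<close>
  moreover have "{\<pi>. \<pi> \<in> NC n \<and> refines {1..n} \<pi> (nc_top n)} = NC n"
    using nc_top_in_NC[OF n] by (auto simp: NC_def refines_def nc_top_def partition_on_def)
  moreover have "(\<Prod>V\<in>nc_top n. k (restrict_block a V)) = k (map a [1..<Suc n])"
    by (simp only: nc_top_def restrict_block_full) (simp add: restrict_block_full del: upt_Suc One_nat_def)
  ultimately show ?thesis by simp
qed

theorem lemma2p1:
  fixes scale :: "complex \<Rightarrow> 'a::ring_1 \<Rightarrow> 'a"
    and B :: "'a set" and \<phi> :: "'a \<Rightarrow> complex" and E :: "'a \<Rightarrow> 'a"
    and k :: "'a list \<Rightarrow> complex"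
    and x :: "nat \<Rightarrow> 'a" and s n :: nat and i :: "nat \<Rightarrow> nat"
  assumes "nc_prob_space scale \<phi>"
    and "nc_prob_space_over scale B E"
    and "compatible \<phi> E"
    and "free_cumulants scale \<phi> k"
    and "n \<ge> 1"
    and "\<forall>j\<in>{1..n}. i j \<in> {1..s}"
  shows "k (map (\<lambda>j. x (i j)) [1..<Suc n]) =
      (\<Sum>\<pi>\<in>NC n. (\<Prod>V\<in>\<pi>. \<phi> (E (prod_list (restrict_block (\<lambda>v. x (i v)) V))))
         * of_int (nc_moebius n \<pi> (nc_top n))) \<and>
    \<phi> (prod_list (map (\<lambda>j. x (i j)) [1..<Suc n])) =
      (\<Sum>\<pi>\<in>NC n. \<Prod>V\<in>\<pi>.
         (\<Sum>\<theta>\<in>NC (card V).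
            (\<Prod>W\<in>\<theta>. \<phi> (E (prod_list (restrict_block (\<lambda>w. x (i (block_nth V w))) W))))
            * of_int (nc_moebius (card V) \<theta> (nc_top (card V)))))"
proof -
  let ?a = "\<lambda>j. x (i j)"
  note k = assms(4)
  \<comment> \<open>Compatibility removes \<open>E\<close> from both formulas, so that scalar
    moments alone remain.\<close>
  have E: "\<phi> (E y) = \<phi> y" for y using assms(3) by (simp add: compatible_def)
  have "\<phi> (prod_list (map ?a [1..<Suc n])) = (\<Sum>\<pi>\<in>NC n. \<Prod>V\<in>\<pi>. k (restrict_block ?a V))"
    using k assms(5) unfolding free_cumulants_def by blast
  also have "\<dots> = (\<Sum>\<pi>\<in>NC n. \<Prod>V\<in>\<pi>.
         (\<Sum>\<theta>\<in>NC (card V).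
            (\<Prod>W\<in>\<theta>. \<phi> (prod_list (restrict_block (\<lambda>w. x (i (block_nth V w))) W)))
            * of_int (nc_moebius (card V) \<theta> (nc_top (card V)))))"
  proof (intro sum.cong prod.cong refl)
    fix \<pi> V assume \<pi>: "\<pi> \<in> NC n" "V \<in> \<pi>"
    then have "card V \<ge> 1"
      using NC_block[OF \<pi>] by (auto simp: Suc_le_eq card_gt_0_iff NC_def partition_on_def)
    \<comment> \<open>Enumerating \<open>V\<close> by \<open>block_nth V\<close> presents the
      arguments of its cumulant as a sequence indexed from 1, which produces the nested indices v_w
      of the inner sum.\<close>
    moreover have "map (\<lambda>w. x (i (block_nth V w))) [1..<Suc (card V)] = restrict_block ?a V"
      unfolding restrict_block_def map_block_nth[of V, symmetric] map_map comp_def ..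
    ultimately show "k (restrict_block ?a V) =
        (\<Sum>\<theta>\<in>NC (card V).
            (\<Prod>W\<in>\<theta>. \<phi> (prod_list (restrict_block (\<lambda>w. x (i (block_nth V w))) W)))
            * of_int (nc_moebius (card V) \<theta> (nc_top (card V))))"
      using free_cumulants_moebius[OF k, of "card V" "\<lambda>w. x (i (block_nth V w))"] by simp
  qed
  finally show ?thesis
    unfolding E using free_cumulants_moebius[OF k assms(5), of ?a] by blast
qed

end
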